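(* Let $\mathcal Y=T^*\mathcal Q$ and let $\tilde{\mathcal L}:T\mathcal Y\to\mathbb R$ be the Lagrangian $$\tilde{\mathcal L}(q,\lambda,\dot q,\dot\lambda)=-\dot\lambda^\top\dot q-\lambda^\top f(q,\dot q)-\tfrac12\,b(q)(\lambda,\lambda),\qquad y=(q,\lambda).$$ Let $G=\{\tilde\Phi_{g_s}:\mathcal Y\to\mathcal Y,\ s\in\mathbb R\}$ be a one-parameter group of transformations, smooth in $(s,y)$, i.e.: - $\tilde\Phi_{g_s}:\mathcal Y\to\mathcal Y$ is a diffeomorphism for all $s\in\mathbb R$; - $\tilde\Phi_{g_s}(y)$ as a function of $s$ is differentiable for all $y\in\mathcal Y$; - $\tilde\Phi_{g_t}\circ\tilde\Phi_{g_s}=\tilde\Phi_{g_{t+s}}$ for all $t,s\in\mathbb R$. Assume that the Lagrangian system $(\mathcal Y,\tilde{\mathcal L})$ is invariant under $G$, i.e. $$\tilde{\mathcal L}\big(\tilde\Phi_{g_s}(y),\,T_y\tilde\Phi_{g_s}(\dot y)\big)=\tilde{\mathcal L}(y,\dot y)\qquad\text{for all } s\in\mathbb R,\ (y,\dot y)\in T\mathcal Y .$$ Then the momentum map $$I(y,\dot y)=\frac{\partial\tilde{\mathcal L}}{\partial\dot y}(y,\dot y)\cdot\frac{d}{ds}\Big|_{s=0}\tilde\Phi_{g_s}(y)$$ is a conserved quantity of the motion: it is constant in time along every solution $y=(q,\lambda)\in C^3([0,T],\mathcal Y)$ of the Euler-Lagrange equations $\frac{\partial\tilde{\mathcal L}}{\partial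 y}(y,\dot y)-\frac{d}{dt}\big(\frac{\partial\tilde{\mathcal L}}{\partial\dot y}(y,\dot y)\big)=0$.
   Context: All formulas are in local coordinates; $\mathcal Q$ is identified with an open subset of $\mathbb R^d$, so $\mathcal Y=T^*\mathcal Q=\mathcal Q\times\mathbb R^d$. Data: $T>0$; a $C^1$ drift $f:T\mathcal Q\to\mathbb R^d$; a $C^1$ matrix function $\rho:\mathcal Q\to\mathbb R^{d\times m}$ ($m\le d$) with $\rho(q)$ injective for all $q$; a Riemannian metric $\mathrm g_{\mathcal Q}$ on $\mathcal Q$, and $\mathrm g(q)=\rho(q)^\top\mathrm g_{\mathcal Q}(q)\rho(q)$ (symmetric positive definite, $C^1$ in $q$). Put $b(q)=\rho(q)\mathrm g(q)^{-1}\rho(q)^\top$ and $b(q)(\lambda,\lambda)=\lambda^\top b(q)\lambda$. $T_y\tilde\Phi_{g_s}$ is the derivative of $\tilde\Phi_{g_s}$ at $y$. The Euler-Lagrange equations include the assertion that $t\mapsto\frac{\partial\tilde{\mathcal L}}{\partial\dot y}(y(t),\dot y(t))$ is differentiable. *)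

theory Defs
  imports "HOL-Analysis.Analysis"
begin

text \<open>
  \<open>C\<^sup>k\<close> maps on an open subset of a finite-dimensional space. Asking every directional
  derivative \<open>x \<mapsto> Df(x)v\<close> to be \<open>C\<^sup>k\<close> is, in finite dimension, the same as asking it of
  \<open>x \<mapsto> Df(x)\<close>, and keeps the codomain fixed in the recursion. The definition is meant for
  open \<open>S\<close> only.
\<close>

primrec Ck_on :: "nat \<Rightarrow> 'a::euclidean_space set \<Rightarrow> ('a \<Rightarrow> 'b::real_normed_vector) \<Rightarrow> bool" where
  "Ck_on 0 S f \<longleftrightarrow> continuous_on S f"
| "Ck_on (Suc k) S f \<longleftrightarrow>
     (\<forall>x\<in>S. f differentiable (at x)) \<and> (\<forall>v. Ck_on k S (\<lambda>x. frechet_derivative f (at x) v))"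

definition smooth_on :: "'a::euclidean_space set \<Rightarrow> ('a \<Rightarrow> 'b::real_normed_vector) \<Rightarrow> bool" where
  "smooth_on S f \<longleftrightarrow> (\<forall>k. Ck_on k S f)"

text \<open>\<open>C\<^sup>k\<close> curves on the closed interval \<open>[0,T]\<close>, with one-sided derivatives at the ends.\<close>

definition velocity :: "real \<Rightarrow> (real \<Rightarrow> 'a::real_normed_vector) \<Rightarrow> real \<Rightarrow> 'a" where
  "velocity T y t = vector_derivative y (at t within {0..T})"

primrec Ck_curve :: "nat \<Rightarrow> real \<Rightarrow> (real \<Rightarrow> 'a::real_normed_vector) \<Rightarrow> bool" where
  "Ck_curve 0 T y \<longleftrightarrow> continuous_on {0..T} y"
| "Ck_curve (Suc k) T y \<longleftrightarrow>
     (\<forall>t\<in>{0..T}. y differentiable (at t within {0..T})) \<and> Ck_curve k T (velocity T y)"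

definition diffeomorphism_on :: "'a::euclidean_space set \<Rightarrow> ('a \<Rightarrow> 'a) \<Rightarrow> bool" where
  "diffeomorphism_on Y \<phi> \<longleftrightarrow>
     bij_betw \<phi> Y Y \<and> smooth_on Y \<phi> \<and> smooth_on Y (inv_into Y \<phi>)"

definition one_parameter_group ::
    "'a::euclidean_space set \<Rightarrow> (real \<Rightarrow> 'a \<Rightarrow> 'a) \<Rightarrow> bool" where
  "one_parameter_group Y \<Phi> \<longleftrightarrow>
     smooth_on (UNIV \<times> Y) (\<lambda>(s, y). \<Phi> s y) \<and>
     (\<forall>s. diffeomorphism_on Y (\<Phi> s)) \<and>
     (\<forall>y\<in>Y. \<forall>s. (\<lambda>s. \<Phi> s y) differentiable (at s)) \<and>
     (\<forall>t s. \<forall>y\<in>Y. \<Phi> t (\<Phi> s y) = \<Phi> (t + s) y)"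

text \<open>
  A Lagrangian on \<open>TY = Y \<times> 'a\<close> is a curried function \<open>L y v\<close> of position and velocity. Its
  partial derivatives are covectors, i.e. elements of the normed dual \<open>'a \<Rightarrow>\<^sub>L real\<close>, so
  that curves of covectors can be differentiated in time. They are meaningful
  only where \<open>L\<close> is differentiable in the respective argument.
\<close>

definition D_pos :: "('a::euclidean_space \<Rightarrow> 'a \<Rightarrow> real) \<Rightarrow> 'a \<Rightarrow> 'a \<Rightarrow> 'a \<Rightarrow>\<^sub>L real" where
  "D_pos L y v = Blinfun (frechet_derivative (\<lambda>x. L x v) (at y))"

definition D_vel :: "('a::euclidean_space \<Rightarrow> 'a \<Rightarrow> real) \<Rightarrow> 'a \<Rightarrow> 'a \<Rightarrow> 'a \<Rightarrow>\<^sub>L real" where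
  "D_vel L y v = Blinfun (frechet_derivative (\<lambda>w. L y w) (at v))"

definition Euler_Lagrange ::
    "('a::euclidean_space \<Rightarrow> 'a \<Rightarrow> real) \<Rightarrow> real \<Rightarrow> (real \<Rightarrow> 'a) \<Rightarrow> bool" where
  "Euler_Lagrange L T y \<longleftrightarrow>
     (let p = (\<lambda>t. D_vel L (y t) (velocity T y t)) in
      \<forall>t\<in>{0..T}. p differentiable (at t within {0..T}) \<and>
        D_pos L (y t) (velocity T y t) - vector_derivative p (at t within {0..T}) = 0)"

definition invariant_Lagrangian ::
    "'a::euclidean_space set \<Rightarrow> ('a \<Rightarrow> 'a \<Rightarrow> real) \<Rightarrow> (real \<Rightarrow> 'a \<Rightarrow> 'a) \<Rightarrow> bool" where
  "invariant_Lagrangian Y L \<Phi> \<longleftrightarrow>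
     (\<forall>s. \<forall>y\<in>Y. \<forall>v. L (\<Phi> s y) (frechet_derivative (\<Phi> s) (at y) v) = L y v)"

definition momentum_map ::
    "('a::euclidean_space \<Rightarrow> 'a \<Rightarrow> real) \<Rightarrow> (real \<Rightarrow> 'a \<Rightarrow> 'a) \<Rightarrow> 'a \<Rightarrow> 'a \<Rightarrow> real" where
  "momentum_map L \<Phi> y v =
     blinfun_apply (D_vel L y v) (vector_derivative (\<lambda>s. \<Phi> s y) (at 0))"

definition riemannian_metric_on ::
    "(real^'d) set \<Rightarrow> (real^'d \<Rightarrow> real^'d^'d) \<Rightarrow> bool" where
  "riemannian_metric_on Q gQ \<longleftrightarrow>
     Ck_on 1 Q gQ \<and>
     (\<forall>q\<in>Q. transpose (gQ q) = gQ q \<and> (\<forall>x. x \<noteq> 0 \<longrightarrow> x \<bullet> (gQ q *v x) > 0))"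

definition control_metric ::
    "(real^'d \<Rightarrow> real^'m^'d) \<Rightarrow> (real^'d \<Rightarrow> real^'d^'d) \<Rightarrow> real^'d \<Rightarrow> real^'m^'m" where
  "control_metric \<rho> gQ q = transpose (\<rho> q) ** gQ q ** \<rho> q"

definition b_matrix ::
    "(real^'d \<Rightarrow> real^'m^'d) \<Rightarrow> (real^'d \<Rightarrow> real^'d^'d) \<Rightarrow> real^'d \<Rightarrow> real^'d^'d" where
  "b_matrix \<rho> gQ q = \<rho> q ** matrix_inv (control_metric \<rho> gQ q) ** transpose (\<rho> q)"

definition new_Lagrangian ::
    "((real^'d) \<times> (real^'d) \<Rightarrow> real^'d) \<Rightarrow> (real^'d \<Rightarrow> real^'m^'d) \<Rightarrow> (real^'d \<Rightarrow> real^'d^'d) \<Rightarrow>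
     (real^'d) \<times> (real^'d) \<Rightarrow> (real^'d) \<times> (real^'d) \<Rightarrow> real" where
  "new_Lagrangian f \<rho> gQ = (\<lambda>(q, l) (q', l').
     - (l' \<bullet> q') - l \<bullet> f (q, q') - 1 / 2 * (l \<bullet> (b_matrix \<rho> gQ q *v l)))"

end

theory Submission imports Defs begin

text \<open>
  Differentiating the invariance identity at \<open>s = 0\<close> gives
  \<open>D_pos L (y, y') X(y) + D_vel L (y, y') (DX(y) y') = 0\<close> with the infinitesimal generator
  \<open>X(y) = d/ds \<Phi>\<^sub>s(y)\<close>; this uses joint differentiability of \<open>L\<close> and the equality of mixed
  partials of \<open>(s, y) \<mapsto> \<Phi>\<^sub>s(y)\<close>. Along a solution of the Euler-Lagrange equations the left hand
  side is the time derivative of the momentum map. For the given Lagrangian joint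
  differentiability comes down to that of the matrix inverse, which Cramer's rule provides.
\<close>

section \<open>Symmetry of second derivatives\<close>

lemma has_derivative_along_line:
  assumes "(F has_derivative D) (at (a + r *\<^sub>R u + b))"
  shows "((\<lambda>r. F (a + r *\<^sub>R u + b)) has_derivative (\<lambda>k. D (k *\<^sub>R u))) (at r within S)"
proof -
  have "((\<lambda>r. a + r *\<^sub>R u + b) has_derivative (\<lambda>k. k *\<^sub>R u)) (at r within S)"
    by (auto intro!: derivative_eq_intros)
  from has_derivative_compose[OF this assms] show ?thesis .
qed

text \<open>Two applications of the mean value theorem: first in \<open>r\<close> to the increment
  of \<open>F\<close> across \<open>h *\<^sub>R v\<close>, then in \<open>s\<close> to the
  directional derivative of \<open>F\<close> along \<open>u\<close>. Linearity of the derivatives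
  pulls out one factor \<open>h\<close> each time.\<close>

lemma second_difference_mean_value:
  fixes F :: "'a::real_normed_vector \<Rightarrow> real"
  assumes h: "h > 0"
    and S: "\<And>r s. 0 \<le> r \<Longrightarrow> r \<le> h \<Longrightarrow> 0 \<le> s \<Longrightarrow> s \<le> h \<Longrightarrow> x + r *\<^sub>R u + s *\<^sub>R v \<in> S"
    and F: "\<And>z. z \<in> S \<Longrightarrow> (F has_derivative F' z) (at z)"
    and A: "\<And>z. z \<in> S \<Longrightarrow> ((\<lambda>z. F' z u) has_derivative A' z) (at z)"
  obtains r s where "0 < r" "r < h" "0 < s" "s < h"
    "F (x + h *\<^sub>R u + h *\<^sub>R v) - F (x + h *\<^sub>R u) - (F (x + h *\<^sub>R v) - F x)
       = h * h * A' (x + r *\<^sub>R u + s *\<^sub>R v) v"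
proof -
  have "((\<lambda>r. F (x + r *\<^sub>R u + h *\<^sub>R v) - F (x + r *\<^sub>R u)) has_derivative
      (\<lambda>k. F' (x + r *\<^sub>R u + h *\<^sub>R v) (k *\<^sub>R u) - F' (x + r *\<^sub>R u) (k *\<^sub>R u))) (at r within {0..h})"
    if "0 \<le> r" "r \<le> h" for r
  proof (intro has_derivative_diff)
    show "((\<lambda>r. F (x + r *\<^sub>R u + h *\<^sub>R v)) has_derivative
        (\<lambda>k. F' (x + r *\<^sub>R u + h *\<^sub>R v) (k *\<^sub>R u))) (at r within {0..h})"
      using that h by (intro has_derivative_along_line F S) auto
    have "x + r *\<^sub>R u \<in> S"
      using S[of r 0] that h by simp
    then show "((\<lambda>r. F (x + r *\<^sub>R u)) has_derivative
        (\<lambda>k. F' (x + r *\<^sub>R u) (k *\<^sub>R u))) (at r within {0..h})"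
      using has_derivative_along_line[of F _ x r u 0] F by simp
  qed
  from mvt_simple[OF h this] obtain r where r: "0 < r" "r < h" and
    1: "F (x + h *\<^sub>R u + h *\<^sub>R v) - F (x + h *\<^sub>R u) - (F (x + h *\<^sub>R v) - F x) =
      F' (x + r *\<^sub>R u + h *\<^sub>R v) (h *\<^sub>R u) - F' (x + r *\<^sub>R u) (h *\<^sub>R u)"
    by auto
  have *: "x + r *\<^sub>R u + s *\<^sub>R v \<in> S" if "0 \<le> s" "s \<le> h" for s
    using S r that by simp
  have "((\<lambda>s. F' (x + r *\<^sub>R u + s *\<^sub>R v) u) has_derivative
      (\<lambda>k. A' (x + r *\<^sub>R u + s *\<^sub>R v) (k *\<^sub>R v))) (at s within {0..h})"
    if "0 \<le> s" "s \<le> h" for s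
    using has_derivative_along_line[of "\<lambda>z. F' z u" _ "x + r *\<^sub>R u" s v 0] A[OF *[OF that]] by simp
  from mvt_simple[OF h this] obtain s where s: "0 < s" "s < h" and
    2: "F' (x + r *\<^sub>R u + h *\<^sub>R v) u - F' (x + r *\<^sub>R u) u = A' (x + r *\<^sub>R u + s *\<^sub>R v) (h *\<^sub>R v)"
    by auto
  have lin: "linear (F' (x + r *\<^sub>R u + h *\<^sub>R v))" "linear (F' (x + r *\<^sub>R u))"
    "linear (A' (x + r *\<^sub>R u + s *\<^sub>R v))"
    using F[OF *[of h]] F[OF *[of 0]] A[OF *[of s]] h s by (auto intro: has_derivative_linear)
  have "F (x + h *\<^sub>R u + h *\<^sub>R v) - F (x + h *\<^sub>R u) - (F (x + h *\<^sub>R v) - F x)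
      = h * (F' (x + r *\<^sub>R u + h *\<^sub>R v) u - F' (x + r *\<^sub>R u) u)"
    unfolding 1 linear_scale[OF lin(1)] linear_scale[OF lin(2)] by (simp add: right_diff_distrib)
  also have "\<dots> = h * h * A' (x + r *\<^sub>R u + s *\<^sub>R v) v"
    unfolding 2 linear_scale[OF lin(3)] by simp
  finally show thesis
    using that r s by blast
qed

text \<open>The second difference over the parallelogram spanned by \<open>h *\<^sub>R u\<close> and
  \<open>h *\<^sub>R v\<close> does not change when \<open>u\<close> and \<open>v\<close> are
  swapped. Evaluating it in both orders equates a value of \<open>A'\<close> with a value of
  \<open>B'\<close>, at two points that are close to \<open>x\<close> for small \<open>h\<close>;
  continuity at \<open>x\<close> then excludes a gap.\<close>

lemma second_derivative_symmetric_real: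
  fixes F :: "'a::real_normed_vector \<Rightarrow> real"
  assumes S: "open S" "x \<in> S"
    and F: "\<And>z. z \<in> S \<Longrightarrow> (F has_derivative F' z) (at z)"
    and A: "\<And>z. z \<in> S \<Longrightarrow> ((\<lambda>z. F' z u) has_derivative A' z) (at z)"
    and B: "\<And>z. z \<in> S \<Longrightarrow> ((\<lambda>z. F' z v) has_derivative B' z) (at z)"
    and contA: "isCont (\<lambda>z. A' z v) x" and contB: "isCont (\<lambda>z. B' z u) x"
  shows "A' x v = B' x u"
proof (rule ccontr)
  assume "A' x v \<noteq> B' x u"
  \<comment> \<open>Half the gap: two errors below \<open>e\<close> cannot bridge it.\<close>
  define e where "e = \<bar>A' x v - B' x u\<bar> / 2"
  have e: "e > 0"
    using \<open>A' x v \<noteq> B' x u\<close> by (simp add: e_def)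
  obtain d0 where d0: "d0 > 0" "ball x d0 \<subseteq> S"
    using S openE by blast
  obtain d1 where d1: "d1 > 0" "\<And>z. dist z x < d1 \<Longrightarrow> dist (A' z v) (A' x v) < e"
    using contA e unfolding continuous_at_eps_delta by blast
  obtain d2 where d2: "d2 > 0" "\<And>z. dist z x < d2 \<Longrightarrow> dist (B' z u) (B' x u) < e"
    using contB e unfolding continuous_at_eps_delta by blast
  define d where "d = min d0 (min d1 d2)"
  \<comment> \<open>This scale keeps the whole parallelogram within distance \<open>d\<close> of
    \<open>x\<close>; the summand 1 keeps the denominator positive even when \<open>u\<close> and
    \<open>v\<close> both vanish.\<close>
  define h where "h = d / (norm u + norm v + 1)"
  have d: "d > 0"
    using d0 d1 d2 by (simp add: d_def)
  have n: "norm u + norm v + 1 > 0"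
    by (simp add: add_nonneg_pos)
  have h: "h > 0"
    using d n by (simp add: h_def)
  have "h * (norm u + norm v) < h * (norm u + norm v + 1)"
    using h by simp
  also have "\<dots> = d"
    using n by (simp add: h_def)
  finally have hd: "h * (norm u + norm v) < d" .
  have near: "dist (x + r *\<^sub>R u + s *\<^sub>R v) x < d" if "0 \<le> r" "r \<le> h" "0 \<le> s" "s \<le> h" for r s
  proof -
    have "dist (x + r *\<^sub>R u + s *\<^sub>R v) x = norm (r *\<^sub>R u + s *\<^sub>R v)"
      by (simp add: dist_norm algebra_simps)
    also have "\<dots> \<le> r * norm u + s * norm v"
      using that by (intro norm_triangle_le) simp
    also have "\<dots> \<le> h * norm u + h * norm v"
      using that by (intro add_mono mult_right_mono) auto
    finally show ?thesis
      using hd by (simp add: algebra_simps)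
  qed
  have S1: "x + r *\<^sub>R u + s *\<^sub>R v \<in> S" "x + s *\<^sub>R v + r *\<^sub>R u \<in> S"
    if "0 \<le> r" "r \<le> h" "0 \<le> s" "s \<le> h" for r s
  proof -
    show "x + r *\<^sub>R u + s *\<^sub>R v \<in> S"
      using near[OF that] d0 by (auto simp: d_def dist_commute)
    then show "x + s *\<^sub>R v + r *\<^sub>R u \<in> S"
      by (simp add: algebra_simps)
  qed
  obtain r s where rs: "0 < r" "r < h" "0 < s" "s < h" and
    1: "F (x + h *\<^sub>R u + h *\<^sub>R v) - F (x + h *\<^sub>R u) - (F (x + h *\<^sub>R v) - F x)
       = h * h * A' (x + r *\<^sub>R u + s *\<^sub>R v) v"
    using second_difference_mean_value[OF h S1(1) F A] .
  obtain s' r' where rs': "0 < s'" "s' < h" "0 < r'" "r' < h" and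
    2: "F (x + h *\<^sub>R v + h *\<^sub>R u) - F (x + h *\<^sub>R v) - (F (x + h *\<^sub>R u) - F x)
       = h * h * B' (x + s' *\<^sub>R v + r' *\<^sub>R u) u"
    using second_difference_mean_value[OF h S1(2) F B] .
  have "h * h * A' (x + r *\<^sub>R u + s *\<^sub>R v) v = h * h * B' (x + s' *\<^sub>R v + r' *\<^sub>R u) u"
    using 1 2 by (simp add: algebra_simps)
  then have "A' (x + r *\<^sub>R u + s *\<^sub>R v) v = B' (x + r' *\<^sub>R u + s' *\<^sub>R v) u"
    using h by (simp add: algebra_simps)
  moreover have "dist (A' (x + r *\<^sub>R u + s *\<^sub>R v) v) (A' x v) < e"
    using near[of r s] rs by (intro d1) (simp add: d_def)
  moreover have "dist (B' (x + r' *\<^sub>R u + s' *\<^sub>R v) u) (B' x u) < e"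
    using near[of r' s'] rs' by (intro d2) (simp add: d_def)
  ultimately have "dist (A' x v) (B' x u) < e + e"
    by (metis dist_commute dist_triangle_less_add)
  then show False
    by (simp add: e_def dist_real_def)
qed

text \<open>The mean value theorem in equality form is scalar, so the real case is applied to the
  components \<open>F z \<bullet> b\<close>.\<close>

lemma second_derivative_symmetric:
  fixes F :: "'a::real_normed_vector \<Rightarrow> 'b::euclidean_space"
  assumes S: "open S" "x \<in> S"
    and F: "\<And>z. z \<in> S \<Longrightarrow> (F has_derivative F' z) (at z)"
    and A: "\<And>z. z \<in> S \<Longrightarrow> ((\<lambda>z. F' z u) has_derivative A' z) (at z)"
    and B: "\<And>z. z \<in> S \<Longrightarrow> ((\<lambda>z. F' z v) has_derivative B' z) (at z)"
    and contA: "isCont (\<lambda>z. A' z v) x" and contB: "isCont (\<lambda>z. B' z u) x"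
  shows "A' x v = B' x u"
proof (rule euclidean_eqI)
  fix b :: 'b
  show "A' x v \<bullet> b = B' x u \<bullet> b"
    by (rule second_derivative_symmetric_real[OF S, of "\<lambda>z. F z \<bullet> b" "\<lambda>z w. F' z w \<bullet> b"])
       (intro has_derivative_inner_left F A B contA contB continuous_intros; assumption)+
qed

section \<open>Symmetry of second derivatives for \<open>Ck_on 2\<close> maps\<close>

lemma Ck_on_2_differentiable:
  assumes "Ck_on 2 S F" "z \<in> S"
  shows "F differentiable (at z)" "(\<lambda>z. frechet_derivative F (at z) w) differentiable (at z)"
  using assms unfolding numeral_2_eq_2 Ck_on.simps by blast+

lemma Ck_on_2_symmetric:
  fixes F :: "'a::euclidean_space \<Rightarrow> 'b::euclidean_space"
  assumes "open S" "x \<in> S" "Ck_on 2 S F"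
  shows "frechet_derivative (\<lambda>z. frechet_derivative F (at z) u) (at x) v =
    frechet_derivative (\<lambda>z. frechet_derivative F (at z) v) (at x) u"
proof -
  have "continuous_on S (\<lambda>z. frechet_derivative (\<lambda>z. frechet_derivative F (at z) w) (at z) w')" for w w'
    using assms by (auto simp: numeral_2_eq_2)
  then have "isCont (\<lambda>z. frechet_derivative (\<lambda>z. frechet_derivative F (at z) w) (at z) w') x" for w w'
    using assms(1,2) continuous_on_eq_continuous_at by blast
  then show ?thesis
    by (intro second_derivative_symmetric[OF assms(1,2), where F = F and F' = "\<lambda>z. frechet_derivative F (at z)"])
       (auto simp: frechet_derivative_works[symmetric] Ck_on_2_differentiable[OF assms(3)])
qed

section \<open>Noether's theorem\<close>

text \<open>The group law at \<open>t = s = 0\<close> makes \<open>\<Phi> 0\<close> idempotent, and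
  an injective idempotent map is the identity.\<close>

lemma one_parameter_group_zero:
  assumes "one_parameter_group Y \<Phi>" "y \<in> Y"
  shows "\<Phi> 0 y = y"
proof -
  have "bij_betw (\<Phi> 0) Y Y" "\<Phi> 0 (\<Phi> 0 y) = \<Phi> 0 y"
    using assms by (auto simp: one_parameter_group_def diffeomorphism_on_def)
  then show ?thesis
    using \<open>y \<in> Y\<close> by (metis bij_betw_apply bij_betw_def inj_onD)
qed

lemma has_derivative_first_argument:
  assumes "(F has_derivative D) (at (a, b))"
  shows "((\<lambda>a. F (a, b)) has_derivative (\<lambda>h. D (h, 0))) (at a)"
proof -
  have "((\<lambda>a. (a, b)) has_derivative (\<lambda>h. (h, 0))) (at a)"
    by (auto intro!: derivative_eq_intros)
  from has_derivative_compose[OF this assms] show ?thesis .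
qed

lemma has_derivative_second_argument:
  assumes "(F has_derivative D) (at (a, b))"
  shows "((\<lambda>b. F (a, b)) has_derivative (\<lambda>h. D (0, h))) (at b)"
proof -
  have "((\<lambda>b. (a, b)) has_derivative (\<lambda>h. (0, h))) (at b)"
    by (auto intro!: derivative_eq_intros)
  from has_derivative_compose[OF this assms] show ?thesis .
qed

text \<open>\<open>X'\<close> is the derivative of the infinitesimal generator. By symmetry of the
  second derivatives of the flow, \<open>X' v\<close> is also the rate of change at
  \<open>s = 0\<close> of the tangent vector \<open>v\<close> transported by
  \<open>\<Phi> s\<close>, which is what the chain rule for the invariance identity
  produces.\<close>

lemma noether_infinitesimal_invariance:
  fixes L :: "'a::euclidean_space \<Rightarrow> 'a \<Rightarrow> real"
  assumes "open Y" "y \<in> Y"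
    and L: "(\<lambda>(y, v). L y v) differentiable (at (y, v))"
    and G: "one_parameter_group Y \<Phi>"
    and inv: "invariant_Lagrangian Y L \<Phi>"
  obtains X' where
    "((\<lambda>y. vector_derivative (\<lambda>s. \<Phi> s y) (at 0)) has_derivative X') (at y)"
    "D_pos L y v (vector_derivative (\<lambda>s. \<Phi> s y) (at 0)) + D_vel L y v (X' v) = 0"
proof -
  define F where "F = (\<lambda>(s, y). \<Phi> s y)"
  define F' where "F' p = frechet_derivative F (at p)" for p
  define S where "S = (UNIV :: real set) \<times> Y"
  define X where "X y = vector_derivative (\<lambda>s. \<Phi> s y) (at 0)" for y
  have S: "open S"
    using \<open>open Y\<close> by (auto simp: S_def open_Times)
  have C2: "Ck_on 2 S F"
    using G by (auto simp: one_parameter_group_def smooth_on_def S_def F_def)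
  have F: "(F has_derivative F' p) (at p)" if "p \<in> S" for p
    using Ck_on_2_differentiable(1)[OF C2 that] by (simp add: F'_def frechet_derivative_works)
  \<comment> \<open>The direction \<open>w\<close> belongs to the inner derivative; the remaining
    argument of \<open>F'' w p\<close> is the direction of the outer one.\<close>
  define F'' where "F'' w p = frechet_derivative (\<lambda>p. F' p w) (at p)" for w p
  have F'': "((\<lambda>p. F' p w) has_derivative F'' w p) (at p)" if "p \<in> S" for p w
    using Ck_on_2_differentiable(2)[OF C2 that] unfolding F''_def F'_def
    by (simp add: frechet_derivative_works)
  have sym: "F'' u p w = F'' w p u" if "p \<in> S" for p u w
    using Ck_on_2_symmetric[OF S that C2] by (simp add: F''_def F'_def)
  have \<Phi>_s: "((\<lambda>s. \<Phi> s z) has_derivative (\<lambda>h. F' (s, z) (h, 0))) (at s)" if "z \<in> Y" for s z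
    using has_derivative_first_argument[OF F[of "(s, z)"]] that by (simp add: F_def S_def)
  have \<Phi>_y: "(\<Phi> s has_derivative (\<lambda>w. F' (s, z) (0, w))) (at z)" if "z \<in> Y" for s z
    using has_derivative_second_argument[OF F[of "(s, z)"]] that by (simp add: F_def S_def)
  \<comment> \<open>On \<open>Y\<close> the generator is the derivative of \<open>F\<close> in the
    pure time direction \<open>(1, 0)\<close>, so differentiating it in space yields a mixed second
    derivative of \<open>F\<close>.\<close>
  have X_eq: "X z = F' (0, z) (1, 0)" if "z \<in> Y" for z
  proof -
    have lin: "linear (F' (0, z))"
      using F[of "(0, z)"] that by (auto simp: S_def intro: has_derivative_linear)
    have "(\<lambda>h. F' (0, z) (h, 0)) = (\<lambda>h. h *\<^sub>R F' (0, z) (1, 0))"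
      using linear_scale[OF lin, of _ "(1, 0)", symmetric] by simp
    then have "((\<lambda>s. \<Phi> s z) has_vector_derivative F' (0, z) (1, 0)) (at 0)"
      using \<Phi>_s[OF that, of 0] by (simp only: has_vector_derivative_def)
    then show ?thesis
      unfolding X_def by (rule vector_derivative_at)
  qed
  have y0: "(0, y) \<in> S"
    using \<open>y \<in> Y\<close> by (simp add: S_def)
  have "((\<lambda>z. F' (0, z) (1, 0)) has_derivative (\<lambda>w. F'' (1, 0) (0, y) (0, w))) (at y)"
    by (rule has_derivative_second_argument[OF F''[OF y0]])
  then have X': "(X has_derivative (\<lambda>w. F'' (1, 0) (0, y) (0, w))) (at y)"
    by (rule has_derivative_transform_within_open[OF _ \<open>open Y\<close> \<open>y \<in> Y\<close>]) (simp add: X_eq)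
  \<comment> \<open>\<open>V s\<close> is the tangent map of \<open>\<Phi> s\<close> at
    \<open>y\<close> applied to \<open>v\<close>.\<close>
  define V where "V s = F' (s, y) (0, v)" for s
  have "(V has_derivative (\<lambda>h. F'' (0, v) (0, y) (h, 0))) (at 0)"
    unfolding V_def
    by (rule has_derivative_first_argument[OF F''[OF y0]])
  then have 1: "((\<lambda>s. (\<Phi> s y, V s)) has_derivative
      (\<lambda>h. (F' (0, y) (h, 0), F'' (0, v) (0, y) (h, 0)))) (at 0)"
    using \<Phi>_s[OF \<open>y \<in> Y\<close>, of 0] by (rule has_derivative_Pair[rotated])
  \<comment> \<open>\<open>\<Phi> 0\<close> agrees with the identity on the open set
    \<open>Y\<close>, so uniqueness of derivatives gives \<open>V 0 = v\<close>; the curve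
    \<open>(\<Phi> s y, V s)\<close> thus starts at \<open>(y, v)\<close>, where \<open>L\<close> is
    differentiated.\<close>
  have "(id has_derivative (\<lambda>w. F' (0, y) (0, w))) (at y)"
    by (rule has_derivative_transform_within_open[OF \<Phi>_y[OF \<open>y \<in> Y\<close>, of 0] \<open>open Y\<close> \<open>y \<in> Y\<close>])
       (simp add: one_parameter_group_zero[OF G])
  then have "(\<lambda>w. F' (0, y) (0, w)) = id"
    by (rule has_derivative_unique[OF _ has_derivative_id])
  then have V0: "V 0 = v"
    by (simp add: V_def fun_eq_iff)
  define L' where "L' = frechet_derivative (\<lambda>(y, v). L y v) (at (y, v))"
  have L': "((\<lambda>(y, v). L y v) has_derivative L') (at (y, v))"
    using L by (simp only: L'_def frechet_derivative_works)
  have "((\<lambda>s. (\<lambda>(y, v). L y v) (\<Phi> s y, V s)) has_derivative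
      (\<lambda>h. L' (F' (0, y) (h, 0), F'' (0, v) (0, y) (h, 0)))) (at 0)"
    by (rule has_derivative_compose[OF 1])
       (use L' in \<open>simp add: one_parameter_group_zero[OF G \<open>y \<in> Y\<close>] V0\<close>)
  moreover have "(\<lambda>s. (\<lambda>(y, v). L y v) (\<Phi> s y, V s)) = (\<lambda>s. L y v)"
  proof
    fix s
    have "V s = frechet_derivative (\<Phi> s) (at y) v"
      by (simp add: V_def frechet_derivative_at[OF \<Phi>_y[OF \<open>y \<in> Y\<close>], symmetric])
    then show "(\<lambda>(y, v). L y v) (\<Phi> s y, V s) = L y v"
      using inv \<open>y \<in> Y\<close> by (simp add: invariant_Lagrangian_def)
  qed
  ultimately have "((\<lambda>s. L y v) has_derivative
      (\<lambda>h. L' (F' (0, y) (h, 0), F'' (0, v) (0, y) (h, 0)))) (at 0)"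
    by (simp only:)
  then have "(\<lambda>h. L' (F' (0, y) (h, 0), F'' (0, v) (0, y) (h, 0))) = (\<lambda>h. 0)"
    by (rule has_derivative_unique[OF _ has_derivative_const])
  \<comment> \<open>Symmetry turns the time derivative of \<open>V\<close> at 0 into the spatial
    derivative of the generator along \<open>v\<close>.\<close>
  from fun_cong[OF this, of 1] have zero: "L' (X y, F'' (1, 0) (0, y) (0, v)) = 0"
    by (simp only: X_eq[OF \<open>y \<in> Y\<close>] sym[OF y0, of "(1, 0)"])
  have "((\<lambda>z. L z v) has_derivative (\<lambda>w. L' (w, 0))) (at y)"
    using has_derivative_first_argument[OF L'] by simp
  \<comment> \<open>\<open>Blinfun\<close> can be undone because the partial derivative, a
    restriction of \<open>L'\<close>, is bounded linear.\<close>
  then have D_pos: "blinfun_apply (D_pos L y v) = (\<lambda>w. L' (w, 0))"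
    unfolding D_pos_def
    by (metis frechet_derivative_at bounded_linear_Blinfun_apply has_derivative_bounded_linear)
  have "((\<lambda>z. L y z) has_derivative (\<lambda>w. L' (0, w))) (at v)"
    using has_derivative_second_argument[OF L'] by simp
  then have D_vel: "blinfun_apply (D_vel L y v) = (\<lambda>w. L' (0, w))"
    unfolding D_vel_def
    by (metis frechet_derivative_at bounded_linear_Blinfun_apply has_derivative_bounded_linear)
  have "L' (a, 0) + L' (0, b) = L' (a, b)" for a b
    using linear_add[OF has_derivative_linear[OF L'], of "(a, 0)" "(0, b)"] by simp
  then have "D_pos L y v (X y) + D_vel L y v (F'' (1, 0) (0, y) (0, v)) = 0"
    using zero by (simp add: D_pos D_vel)
  then show thesis
    using that X' unfolding X_def by blast
qed

text \<open>The momentum is the pairing of \<open>p t\<close> with \<open>X (y t)\<close>. In its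
  time derivative the Euler-Lagrange equations replace the derivative of \<open>p\<close> by
  \<open>D_pos\<close>, and the two terms of the product rule cancel by infinitesimal
  invariance.\<close>

theorem noether:
  fixes L :: "'a::euclidean_space \<Rightarrow> 'a \<Rightarrow> real"
  assumes Y: "open Y"
    and L: "\<And>y v. y \<in> Y \<Longrightarrow> (\<lambda>(y, v). L y v) differentiable (at (y, v))"
    and G: "one_parameter_group Y \<Phi>"
    and inv: "invariant_Lagrangian Y L \<Phi>"
    and y: "\<And>t. t \<in> {0..T} \<Longrightarrow> y differentiable (at t within {0..T})"
    and yY: "\<And>t. t \<in> {0..T} \<Longrightarrow> y t \<in> Y"
    and EL: "Euler_Lagrange L T y"
  shows "(\<lambda>t. momentum_map L \<Phi> (y t) (velocity T y t)) constant_on {0..T}"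
proof -
  define p where "p t = D_vel L (y t) (velocity T y t)" for t
  define X where "X z = vector_derivative (\<lambda>s. \<Phi> s z) (at 0)" for z
  have "((\<lambda>t. blinfun_apply (p t) (X (y t))) has_derivative (\<lambda>h. 0)) (at t within {0..T})"
    if t: "t \<in> {0..T}" for t
  proof -
    define v where "v = velocity T y t"
    have p: "(p has_vector_derivative D_pos L (y t) v) (at t within {0..T})"
    proof -
      have "p differentiable (at t within {0..T})"
        "D_pos L (y t) v - vector_derivative p (at t within {0..T}) = 0"
        using EL t by (simp_all add: Euler_Lagrange_def Let_def p_def[abs_def] v_def)
      then show ?thesis
        by (simp add: vector_derivative_works)
    qed
    have y': "(y has_vector_derivative v) (at t within {0..T})"
      using y[OF t] by (simp add: v_def velocity_def vector_derivative_works[symmetric])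
    obtain X' where X': "(X has_derivative X') (at (y t))"
      and zero: "D_pos L (y t) v (X (y t)) + D_vel L (y t) v (X' v) = 0"
      using noether_infinitesimal_invariance[OF Y yY[OF t] L[OF yY[OF t]] G inv]
      unfolding X_def .
    have "((\<lambda>t. X (y t)) has_derivative (\<lambda>h. X' (h *\<^sub>R v))) (at t within {0..T})"
      using y' X' unfolding has_vector_derivative_def by (rule has_derivative_compose)
    then have "((\<lambda>t. blinfun_apply (p t) (X (y t))) has_derivative
        (\<lambda>h. p t (X' (h *\<^sub>R v)) + (h *\<^sub>R D_pos L (y t) v) (X (y t)))) (at t within {0..T})"
      by (rule blinfun.FDERIV[OF p[unfolded has_vector_derivative_def]])
    \<comment> \<open>Linearity extracts the time increment \<open>h\<close>, leaving the left side
      of the infinitesimal identity \<open>zero\<close>.\<close>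
    moreover have "p t (X' (h *\<^sub>R v)) + (h *\<^sub>R D_pos L (y t) v) (X (y t)) = 0" for h
    proof -
      have "p t (X' (h *\<^sub>R v)) + (h *\<^sub>R D_pos L (y t) v) (X (y t)) =
          h * (D_pos L (y t) v (X (y t)) + D_vel L (y t) v (X' v))"
        by (simp add: linear_scale[OF has_derivative_linear[OF X']] blinfun.scaleR_left
            blinfun.scaleR_right p_def v_def algebra_simps)
      then show ?thesis
        by (simp add: zero)
    qed
    ultimately show ?thesis
      by simp
  qed
  \<comment> \<open>The interval is convex, so a vanishing derivative within it, one-sided at the
    ends, forces constancy.\<close>
  then have "\<exists>c. \<forall>t\<in>{0..T}. blinfun_apply (p t) (X (y t)) = c"
    by (intro has_derivative_zero_constant) auto
  then show ?thesis
    by (simp add: constant_on_def momentum_map_def p_def X_def)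
qed

section \<open>Differentiability of the Lagrangian\<close>

lemma differentiable_vec_nth:
  fixes f :: "'a::real_normed_vector \<Rightarrow> 'b::euclidean_space^'n"
  assumes "f differentiable (at x within S)"
  shows "(\<lambda>x. f x $ i) differentiable (at x within S)"
  using assms bounded_linear.has_derivative[OF bounded_linear_vec_nth]
  unfolding differentiable_def by blast

text \<open>A basis vector of the product space lives on a single axis, so the inner product with it
  involves one component only.\<close>

lemma differentiable_vec_componentwise:
  fixes f :: "'a::euclidean_space \<Rightarrow> 'b::euclidean_space^'n"
  assumes "\<And>i. (\<lambda>x. f x $ i) differentiable (at x within S)"
  shows "f differentiable (at x within S)"
  using assms
  by (subst differentiable_componentwise_within)
     (auto simp: Basis_vec_def inner_axis intro!: differentiable_inner)

lemma differentiable_matrix_mult: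
  fixes A :: "'a::euclidean_space \<Rightarrow> real^'n^'m" and B :: "'a \<Rightarrow> real^'k^'n"
  assumes "A differentiable (at x within S)" "B differentiable (at x within S)"
  shows "(\<lambda>x. A x ** B x) differentiable (at x within S)"
  by (intro differentiable_vec_componentwise)
     (simp add: matrix_matrix_mult_def differentiable_vec_nth assms)

lemma differentiable_matrix_vector_mult:
  fixes A :: "'a::euclidean_space \<Rightarrow> real^'n^'m" and v :: "'a \<Rightarrow> real^'n"
  assumes "A differentiable (at x within S)" "v differentiable (at x within S)"
  shows "(\<lambda>x. A x *v v x) differentiable (at x within S)"
  by (intro differentiable_vec_componentwise)
     (simp add: matrix_vector_mult_def differentiable_vec_nth assms)

lemma differentiable_transpose:
  fixes A :: "'a::euclidean_space \<Rightarrow> real^'n^'m"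
  assumes "A differentiable (at x within S)"
  shows "(\<lambda>x. transpose (A x)) differentiable (at x within S)"
  by (intro differentiable_vec_componentwise)
     (auto simp: transpose_def intro!: differentiable_vec_nth assms)

lemma differentiable_prod:
  fixes f :: "'i \<Rightarrow> 'a::real_normed_vector \<Rightarrow> 'b::real_normed_field"
  assumes "\<And>i. i \<in> I \<Longrightarrow> f i differentiable (at x within S)"
  shows "(\<lambda>x. \<Prod>i\<in>I. f i x) differentiable (at x within S)"
  using assms by (induction I rule: infinite_finite_induct) auto

lemma differentiable_det:
  fixes A :: "'a::euclidean_space \<Rightarrow> real^'n^'n"
  assumes "A differentiable (at x within S)"
  shows "(\<lambda>x. det (A x)) differentiable (at x within S)"
  unfolding det_def
  by (intro differentiable_sum ballI differentiable_mult differentiable_const differentiable_prod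
      differentiable_vec_nth assms finite_permutations finite)

section \<open>Cramer's rule and differentiability of the matrix inverse\<close>

lemma matrix_inv_right:
  fixes A :: "real^'n^'n"
  assumes "det A \<noteq> 0"
  shows "A ** matrix_inv A = mat 1"
proof -
  have "\<exists>B. A ** B = mat 1 \<and> B ** A = mat 1"
    using assms invertible_det_nz[of A] by (simp add: invertible_def)
  then show ?thesis
    unfolding matrix_inv_def by (rule someI2_ex) simp
qed

text \<open>Column \<open>l\<close> of the inverse solves the linear system whose right side is
  column \<open>l\<close> of the identity. Cramer's rule makes each entry a quotient of
  determinants, which is visibly differentiable in the entries of \<open>A\<close>.\<close>

lemma matrix_inv_cramer:
  fixes A :: "real^'n^'n"
  assumes "det A \<noteq> 0"
  shows "matrix_inv A $ k $ l = det (\<chi> i j. if j = k then mat 1 $ i $ l else A $ i $ j) / det A"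
proof -
  have "A *v column l (matrix_inv A) = column l (mat 1)"
    using matrix_inv_right[OF assms]
    by (simp add: vec_eq_iff column_def matrix_vector_mult_def matrix_matrix_mult_def)
  then have "column l (matrix_inv A) =
      (\<chi> k. det (\<chi> i j. if j = k then column l (mat 1) $ i else A $ i $ j) / det A)"
    using cramer[OF assms] by blast
  then have "column l (matrix_inv A) $ k =
      det (\<chi> i j. if j = k then column l (mat 1) $ i else A $ i $ j) / det A"
    by simp
  then show ?thesis
    by (simp add: column_def cong: if_cong)
qed

text \<open>The Cramer quotient agrees with the inverse where the determinant is nonzero; the open
  set \<open>S\<close> supplies a neighbourhood on which one can replace the other.\<close>

lemma differentiable_matrix_inv:
  fixes A :: "'a::euclidean_space \<Rightarrow> real^'n^'n"
  assumes A: "A differentiable (at x)" and S: "open S" "x \<in> S"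
    and nz: "\<And>z. z \<in> S \<Longrightarrow> det (A z) \<noteq> 0"
  shows "(\<lambda>x. matrix_inv (A x)) differentiable (at x)"
proof (intro differentiable_vec_componentwise)
  fix k l
  \<comment> \<open>This is \<open>A z\<close> with column \<open>k\<close> replaced by the
    \<open>l\<close>-th unit vector; each entry is constant or an entry of
    \<open>A z\<close>.\<close>
  let ?C = "\<lambda>z. (\<chi> i j. if j = k then mat 1 $ i $ l else A z $ i $ j) :: real^'n^'n"
  have "(\<lambda>z. ?C z $ i $ j) differentiable (at x)" for i j
    by (cases "j = k") (simp_all add: differentiable_vec_nth A)
  then have "?C differentiable (at x)"
    by (intro differentiable_vec_componentwise)
  then have "(\<lambda>z. det (?C z) / det (A z)) differentiable (at x)"
    using nz[OF S(2)] by (intro differentiable_divide differentiable_det A)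
  then obtain D where "((\<lambda>z. det (?C z) / det (A z)) has_derivative D) (at x)"
    unfolding differentiable_def by blast
  then have "((\<lambda>z. matrix_inv (A z) $ k $ l) has_derivative D) (at x)"
    by (rule has_derivative_transform_within_open[OF _ S]) (simp add: matrix_inv_cramer nz)
  then show "(\<lambda>z. matrix_inv (A z) $ k $ l) differentiable (at x)"
    by (rule differentiableI)
qed

text \<open>The kernel is trivial: if the control metric sends \<open>u\<close> to 0, then
  \<open>\<rho> q *v u\<close> has zero length in the positive definite \<open>gQ q\<close>, hence
  vanishes, and injectivity gives \<open>u = 0\<close>.\<close>

lemma det_control_metric:
  assumes "riemannian_metric_on Q gQ" "q \<in> Q" "inj (\<lambda>u. \<rho> q *v u)"
  shows "det (control_metric \<rho> gQ q) \<noteq> 0"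
proof -
  have "u = 0" if "control_metric \<rho> gQ q *v u = 0" for u
  proof -
    have "(\<rho> q *v u) \<bullet> (gQ q *v (\<rho> q *v u)) = u \<bullet> (control_metric \<rho> gQ q *v u)"
      by (simp only: control_metric_def matrix_vector_mul_assoc[symmetric] transpose_matrix_vector
          inner_commute[of u] dot_lmul_matrix) (rule inner_commute)
    also have "\<dots> = 0"
      by (simp add: that)
    finally have "\<rho> q *v u = 0"
      using assms(1,2) by (force simp: riemannian_metric_on_def)
    then have "\<rho> q *v u = \<rho> q *v 0"
      by simp
    then show ?thesis
      by (rule injD[OF assms(3)])
  qed
  then show ?thesis
    by (metis invertible_det_nz invertible_left_inverse matrix_left_invertible_ker)
qed

text \<open>The coordinates are linear projections of the point of the tangent bundle, and the
  Lagrangian combines them with \<open>f\<close> and \<open>b_matrix\<close> by sums and inner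
  products. Differentiability of \<open>b_matrix\<close> rests on the invertibility of the control
  metric throughout \<open>Q\<close>.\<close>

lemma differentiable_new_Lagrangian:
  fixes f :: "(real^'d) \<times> (real^'d) \<Rightarrow> real^'d" and \<rho> :: "real^'d \<Rightarrow> real^'m^'d"
  assumes "open Q" "q \<in> Q"
    and f: "f differentiable (at (q, q'))"
    and \<rho>: "\<rho> differentiable (at q)"
    and inj: "\<forall>q\<in>Q. inj (\<lambda>u. \<rho> q *v u)"
    and g: "riemannian_metric_on Q gQ"
  shows "(\<lambda>(y, v). new_Lagrangian f \<rho> gQ y v) differentiable (at ((q, l), (q', l')))"
proof -
  let ?z = "((q, l), (q', l'))"
  have gQ: "gQ differentiable (at q)"
    using g \<open>q \<in> Q\<close> by (simp add: riemannian_metric_on_def)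
  have cm: "control_metric \<rho> gQ differentiable (at q)"
    unfolding control_metric_def[abs_def]
    by (intro differentiable_matrix_mult differentiable_transpose \<rho> gQ)
  have b: "b_matrix \<rho> gQ differentiable (at q)"
    unfolding b_matrix_def[abs_def]
    using det_control_metric[OF g] inj
    by (intro differentiable_matrix_mult differentiable_transpose \<rho>
        differentiable_matrix_inv[OF cm assms(1,2)]) auto
  have proj: "(\<lambda>z. fst (fst z)) differentiable (at ?z)" "(\<lambda>z. snd (fst z)) differentiable (at ?z)"
    "(\<lambda>z. fst (snd z)) differentiable (at ?z)" "(\<lambda>z. snd (snd z)) differentiable (at ?z)"
    by (auto intro!: bounded_linear_imp_differentiable bounded_linear_compose[OF bounded_linear_fst]
        bounded_linear_compose[OF bounded_linear_snd] bounded_linear_fst bounded_linear_snd)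
  have "(\<lambda>z. (fst (fst z), fst (snd z))) differentiable (at ?z)"
    by (rule differentiableI[OF has_derivative_Pair[OF proj(1,3)[unfolded frechet_derivative_works]]])
  then have fz: "(\<lambda>z. f (fst (fst z), fst (snd z))) differentiable (at ?z)"
    using differentiable_compose[of f "\<lambda>z. (fst (fst z), fst (snd z))" ?z UNIV] f by simp
  have bz: "(\<lambda>z. b_matrix \<rho> gQ (fst (fst z))) differentiable (at ?z)"
    using differentiable_compose[of "b_matrix \<rho> gQ" "\<lambda>z. fst (fst z)" ?z UNIV] b proj(1) by simp
  have "(\<lambda>z. - (snd (snd z) \<bullet> fst (snd z)) - snd (fst z) \<bullet> f (fst (fst z), fst (snd z))
      - 1 / 2 * (snd (fst z) \<bullet> (b_matrix \<rho> gQ (fst (fst z)) *v snd (fst z)))) differentiable (at ?z)"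
    by (intro differentiable_diff differentiable_minus differentiable_mult differentiable_const
        differentiable_inner differentiable_matrix_vector_mult proj fz bz)
  then show ?thesis
    by (simp add: new_Lagrangian_def case_prod_unfold)
qed

theorem proposition3p11:
  fixes Q :: "(real^'d) set"
    and T :: real
    and f :: "(real^'d) \<times> (real^'d) \<Rightarrow> real^'d"
    and \<rho> :: "real^'d \<Rightarrow> real^'m^'d"
    and gQ :: "real^'d \<Rightarrow> real^'d^'d"
    and \<Phi> :: "real \<Rightarrow> (real^'d) \<times> (real^'d) \<Rightarrow> (real^'d) \<times> (real^'d)"
    and y :: "real \<Rightarrow> (real^'d) \<times> (real^'d)"
  assumes "open Q"
    and "T > 0"
    and "Ck_on 1 (Q \<times> UNIV) f"
    and "CARD('m) \<le> CARD('d)"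
    and "Ck_on 1 Q \<rho>"
    and "\<forall>q\<in>Q. inj (\<lambda>u. \<rho> q *v u)"
    and "riemannian_metric_on Q gQ"
    and "one_parameter_group (Q \<times> UNIV) \<Phi>"
    and "invariant_Lagrangian (Q \<times> UNIV) (new_Lagrangian f \<rho> gQ) \<Phi>"
    and "Ck_curve 3 T y"
    and "\<forall>t\<in>{0..T}. y t \<in> Q \<times> UNIV"
    and "Euler_Lagrange (new_Lagrangian f \<rho> gQ) T y"
  shows "(\<lambda>t. momentum_map (new_Lagrangian f \<rho> gQ) \<Phi> (y t) (velocity T y t)) constant_on {0..T}"
proof (rule noether)
  show "open (Q \<times> (UNIV :: (real^'d) set))"
    using assms(1) by (simp add: open_Times)
next
  fix y v :: "(real^'d) \<times> (real^'d)"
  assume "y \<in> Q \<times> UNIV"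
  moreover have "\<rho> differentiable (at q)" if "q \<in> Q" for q
    using assms(5) that by simp
  moreover have "f differentiable (at (q, q'))" if "q \<in> Q" for q q'
    using assms(3) that by simp
  ultimately show "(\<lambda>(y, v). new_Lagrangian f \<rho> gQ y v) differentiable (at (y, v))"
    using differentiable_new_Lagrangian[OF assms(1) _ _ _ assms(6,7)] by (cases y; cases v) auto
next
  fix t
  assume t: "t \<in> {0..T}"
  then show "y differentiable (at t within {0..T})"
    \<comment> \<open>Writing 3 as a successor exposes the first differentiability clause of
      \<open>Ck_curve\<close>.\<close>
    using assms(10) by (simp add: numeral_3_eq_3)
  show "y t \<in> Q \<times> UNIV"
    using assms(11) t by blast
qed (use assms in blast)+

end
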